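(* Let $A\ge 2$ and consider a competing growth process $(v_a(\tau_n))_{a\in[A],n\in\mathbb{N}_0}$ with waiting times $(X^{(a)}_j)_{a\in[A],j\in\mathbb{N}}$, as defined in the context. Let $(X_j)_{j\in\mathbb{N}}$ and $(X'_j)_{j\in\mathbb{N}}$ be two independent sequences, each with the same law as $(X^{(1)}_j)_{j\in\mathbb{N}}$. If the series $\sum_{j=1}^\infty(X_j-X'_j)$ converges almost surely, $\sum_{j=1}^\infty\mathbb{P}(X_j-X'_j\ne0)=\infty$, and for any $\varepsilon>0$ $$\sum_{j=1}^\infty\mathbb{P}(X_j>\varepsilon)<\infty,$$ then strict leadership occurs with probability one.
   Context: Notation: $[A]=\{1,\dots,A\}$, $\mathbb{N}=\{1,2,\dots\}$, $\mathbb{N}_0=\mathbb{N}\cup\{0\}$; empty sums are $0$. Competing growth process. Let $A\ge2$ be the number of agents. To each agent $a\in[A]$ is associated a sequence $(X^{(a)}_j)_{j\in\mathbb{N}}$ of $[0,\infty)$-valued random variables. All the variables $X^{(a)}_j$ ($a\in[A]$, $j\in\mathbb{N}$) are mutually independent, and the sequences $(X^{(a)}_j)_{j\in\mathbb{N}}$ have the same law for all $a$ (for fixed $a$, the law of $X^{(a)}_j$ may depend on $j$). Agent $a$ has a deterministic initial value $m_a\in\mathbb{N}_0$ (arbitrary), and $X^{(a)}_k$ is the time taken for the value of $a$ to increase from $k-1$ to $k$. That is, the value $v_a(t)$ of $a$ at time $t\ge0$ satisfies, for $k\in\mathbb{N}_0$, $$v_a(t)=m_a+k \iff \sum_{j=m_a+1}^{m_a+k}X^{(a)}_j\le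 t<\sum_{j=m_a+1}^{m_a+k+1}X^{(a)}_j,$$ and $v_a(t)=\infty$ if $t\ge\sum_{j=m_a+1}^\infty X^{(a)}_j$. Set $\tau_0:=0$ and, for $n\in\mathbb{N}$, $\tau_n:=\inf\{t\ge0:\sum_{a=1}^A v_a(t)\ge n\}$. The competing growth process is $(v_a(\tau_n))_{a\in[A],n\in\mathbb{N}_0}$. It is a standing assumption that this process is $\mathbb{N}_0$-valued, i.e. almost surely $v_a(\tau_n)<\infty$ for all $a\in[A]$, $n\in\mathbb{N}_0$ (explosion, $\lim_n\tau_n<\infty$, is allowed). Strict leadership is the event that there is $a\in[A]$ such that, for all but finitely many $n$, $v_a(\tau_n)>v_{a'}(\tau_n)$ for every $a'\ne a$. A series converges if its partial sums converge to a finite real limit. *)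

theory Defs
  imports "HOL-Probability.Probability"
begin

text \<open>
  Agents are \<open>{1..A}\<close> and waiting times are indexed by \<open>{1..}\<close>; values of the functions
  \<open>m\<close>, \<open>X\<close> at other indices are irrelevant.
\<close>

text \<open>
  Value at time \<open>t \<ge> 0\<close> of an agent with initial value \<open>m\<close> and waiting times \<open>x\<close>. For
  nonnegative \<open>x\<close> at most one \<open>k\<close> qualifies, and none does iff \<open>t\<close> is at least the sum of all
  waiting times from \<open>m + 1\<close> on; see \<open>agent_value_eq_enat_iff\<close> and
  \<open>agent_value_eq_infinity_iff\<close>.
\<close>

definition agent_value :: "nat \<Rightarrow> (nat \<Rightarrow> real) \<Rightarrow> real \<Rightarrow> enat" where
  "agent_value m x t =
    (if \<exists>k. (\<Sum>j=m+1..m+k. x j) \<le> t \<and> t < (\<Sum>j=m+1..m+k+1. x j)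
     then enat (m + (THE k. (\<Sum>j=m+1..m+k. x j) \<le> t \<and> t < (\<Sum>j=m+1..m+k+1. x j)))
     else \<infinity>)"

lemma agent_value_unique:
  fixes x :: "nat \<Rightarrow> real"
  assumes nn: "\<And>j. 1 \<le> j \<Longrightarrow> 0 \<le> x j"
    and k: "(\<Sum>j=m+1..m+k. x j) \<le> t \<and> t < (\<Sum>j=m+1..m+k+1. x j)"
    and l: "(\<Sum>j=m+1..m+l. x j) \<le> t \<and> t < (\<Sum>j=m+1..m+l+1. x j)"
  shows "k = l"
proof (rule ccontr)
  assume "k \<noteq> l"
  then consider "k + 1 \<le> l" | "l + 1 \<le> k" by linarith
  then show False
  proof cases
    case 1
    have "(\<Sum>j=m+1..m+k+1. x j) \<le> (\<Sum>j=m+1..m+l. x j)"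
      using nn 1 by (intro sum_mono2) auto
    then show False using k l by linarith
  next
    case 2
    have "(\<Sum>j=m+1..m+l+1. x j) \<le> (\<Sum>j=m+1..m+k. x j)"
      using nn 2 by (intro sum_mono2) auto
    then show False using k l by linarith
  qed
qed

lemma agent_value_eq_enat_iff:
  fixes x :: "nat \<Rightarrow> real"
  assumes nn: "\<And>j. 1 \<le> j \<Longrightarrow> 0 \<le> x j"
  shows "agent_value m x t = enat (m + k) \<longleftrightarrow>
    (\<Sum>j=m+1..m+k. x j) \<le> t \<and> t < (\<Sum>j=m+1..m+k+1. x j)"
proof -
  define B where "B k \<longleftrightarrow> (\<Sum>j=m+1..m+k. x j) \<le> t \<and> t < (\<Sum>j=m+1..m+k+1. x j)" for k
  have unique: "k = l" if "B k" "B l" for k l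
    using agent_value_unique[of x m k t l] nn that unfolding B_def by blast
  have "agent_value m x t = (if \<exists>k. B k then enat (m + (THE k. B k)) else \<infinity>)"
    unfolding agent_value_def B_def ..
  moreover have "(THE k. B k) = l" if "B l" for l
    using that unique by (intro the_equality) auto
  ultimately have "agent_value m x t = enat (m + k) \<longleftrightarrow> B k"
    by (cases "\<exists>l. B l") auto
  then show ?thesis unfolding B_def .
qed

lemma agent_value_eq_infinity_iff:
  fixes x :: "nat \<Rightarrow> real"
  assumes nn: "\<And>j. 1 \<le> j \<Longrightarrow> 0 \<le> x j" and t: "0 \<le> t"
  shows "agent_value m x t = \<infinity> \<longleftrightarrow> (\<Sum>i. ennreal (x (m + 1 + i))) \<le> ennreal t"
proof -
  define S where "S k = (\<Sum>j=m+1..m+k. x j)" for k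
  have S: "S k = (\<Sum>i<k. x (m + 1 + i))" for k
    unfolding S_def by (induction k) simp_all
  have "agent_value m x t = \<infinity> \<longleftrightarrow> (\<forall>k. S k \<le> t \<longrightarrow> S (Suc k) \<le> t)"
    unfolding agent_value_def S_def by (auto simp del: sum.cl_ivl_Suc simp: not_less)
  also have "\<dots> \<longleftrightarrow> (\<forall>k. S k \<le> t)"
  proof
    assume step: "\<forall>k. S k \<le> t \<longrightarrow> S (Suc k) \<le> t"
    have "S k \<le> t" for k
      by (induction k) (use step t in \<open>auto simp: S\<close>)
    then show "\<forall>k. S k \<le> t" by blast
  qed blast
  also have "\<dots> \<longleftrightarrow> (\<forall>k. (\<Sum>i<k. ennreal (x (m + 1 + i))) \<le> ennreal t)"
    using t nn by (simp add: S sum_ennreal sum_nonneg ennreal_le_iff)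
  also have "\<dots> \<longleftrightarrow> (\<Sum>i. ennreal (x (m + 1 + i))) \<le> ennreal t"
    by (simp add: suminf_eq_SUP SUP_le_iff)
  finally show ?thesis .
qed

text \<open>
  \<open>\<tau>\<^sub>n\<close>. The set is nonempty and bounded below, so the real infimum is the intended one.
\<close>

definition growth_time :: "nat \<Rightarrow> (nat \<Rightarrow> nat) \<Rightarrow> (nat \<Rightarrow> nat \<Rightarrow> real) \<Rightarrow> nat \<Rightarrow> real" where
  "growth_time A m x n =
    (if n = 0 then 0
     else Inf {t. 0 \<le> t \<and> enat n \<le> (\<Sum>a=1..A. agent_value (m a) (x a) t)})"

definition growth_process ::
    "nat \<Rightarrow> (nat \<Rightarrow> nat) \<Rightarrow> (nat \<Rightarrow> nat \<Rightarrow> real) \<Rightarrow> nat \<Rightarrow> nat \<Rightarrow> enat" where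
  "growth_process A m x a n = agent_value (m a) (x a) (growth_time A m x n)"

definition strict_leadership :: "nat \<Rightarrow> (nat \<Rightarrow> nat \<Rightarrow> enat) \<Rightarrow> bool" where
  "strict_leadership A v \<longleftrightarrow>
    (\<exists>a\<in>{1..A}. \<forall>\<^sub>F n in sequentially. \<forall>a'\<in>{1..A} - {a}. v a' n < v a n)"

text \<open>The law of a sequence \<open>(Z\<^sub>j)\<close>, \<open>j \<ge> 1\<close>, as a measure on the product space.\<close>

abbreviation seq_space :: "(nat \<Rightarrow> real) measure" where
  "seq_space \<equiv> \<Pi>\<^sub>M j\<in>{1..}. borel"

abbreviation as_seq :: "(nat \<Rightarrow> 'a \<Rightarrow> real) \<Rightarrow> 'a \<Rightarrow> nat \<Rightarrow> real" where
  "as_seq Z \<equiv> \<lambda>\<omega>. \<lambda>j\<in>{1..}. Z j \<omega>"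

definition seq_law :: "'a measure \<Rightarrow> (nat \<Rightarrow> 'a \<Rightarrow> real) \<Rightarrow> (nat \<Rightarrow> real) measure" where
  "seq_law M Z = distr M seq_space (as_seq Z)"

locale competing_growth = prob_space M for M :: "'a measure" +
  fixes A :: nat and m :: "nat \<Rightarrow> nat" and X :: "nat \<Rightarrow> nat \<Rightarrow> 'a \<Rightarrow> real"
  assumes two_agents: "2 \<le> A"
    and waiting_nonneg: "\<lbrakk>a \<in> {1..A}; 1 \<le> j; \<omega> \<in> space M\<rbrakk> \<Longrightarrow> 0 \<le> X a j \<omega>"
    and waiting_indep: "indep_vars (\<lambda>_. borel) (\<lambda>(a, j). X a j) ({1..A} \<times> {1..})"
    and waiting_same_law: "\<lbrakk>a \<in> {1..A}; b \<in> {1..A}\<rbrakk> \<Longrightarrow> seq_law M (X a) = seq_law M (X b)"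
    and process_finite: "AE \<omega> in M. \<forall>a\<in>{1..A}. \<forall>n.
      growth_process A m (\<lambda>a j. X a j \<omega>) a n < \<infinity>"

end

theory Submission imports Defs begin

text \<open>
  Let \<open>T\<^sub>a(k)\<close> be the time at which agent \<open>a\<close> reaches the value \<open>k\<close>. For \<open>a \<noteq> b\<close> the difference
  \<open>T\<^sub>a(k) - T\<^sub>b(k)\<close> converges almost surely, and the heart of the matter is that its limit has no
  atom at \<open>0\<close>. Put \<open>\<zeta>\<^sub>j = X\<^sub>j\<^sup>a - X\<^sub>j\<^sup>b\<close>. As \<open>\<zeta>\<^sub>j \<rightarrow> 0\<close> and \<open>\<zeta>\<^sub>j \<noteq> 0\<close> infinitely often by Borel-Cantelli,
  there are almost surely infinitely many indices \<open>j\<close> at which \<open>\<bar>\<zeta>\<^sub>j\<bar>\<close> takes a new nonzero value.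
  Exchanging \<open>X\<^sub>j\<^sup>a\<close> and \<open>X\<^sub>j\<^sup>b\<close> preserves the law, fixes this set of indices and subtracts
  \<open>2 \<zeta>\<^sub>j\<close> from the limit; so the events ``\<open>j\<close> is such an index and the limit is \<open>0\<close>'' have the same
  probabilities as the events ``\<open>j\<close> is such an index and the limit is \<open>2 \<zeta>\<^sub>j\<close>'', which are disjoint.
  Their probabilities are therefore summable, and by Borel-Cantelli a zero limit almost surely
  allows only finitely many such indices, which is absurd.

  Hence the limits order the agents strictly. Since also \<open>X\<^sub>k \<rightarrow> 0\<close>, the fastest agent \<open>a\<close> eventually
  satisfies \<open>T\<^sub>a(k + 1) < T\<^sub>b(k)\<close> for all \<open>b \<noteq> a\<close>, which is strict leadership.
\<close>

section \<open>Growth paths\<close>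

text \<open>Values and arrival times are inverse to each other, so every comparison of values
  becomes one of partial sums. The cases \<open>k \<le> m\<close>, where the sum is empty, and
  explosion are included.\<close>

lemma le_agent_value_iff:
  fixes x :: "nat \<Rightarrow> real"
  assumes nn: "\<And>j. 1 \<le> j \<Longrightarrow> 0 \<le> x j" and t: "0 \<le> t"
  shows "enat k \<le> agent_value m x t \<longleftrightarrow> (\<Sum>j=m+1..k. x j) \<le> t"
proof (cases "agent_value m x t")
  case (enat v)
  have "m \<le> v"
    using enat by (auto simp: agent_value_def split: if_splits)
  then obtain i where v: "v = m + i"
    using le_Suc_ex by blast
  have bounds: "(\<Sum>j=m+1..v. x j) \<le> t" "t < (\<Sum>j=m+1..v+1. x j)"
    using enat agent_value_eq_enat_iff[of x m t i] nn unfolding v by auto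
  have mono: "(\<Sum>j=m+1..k. x j) \<le> (\<Sum>j=m+1..l. x j)" if "k \<le> l" for k l
    using that nn by (intro sum_mono2) auto
  show ?thesis
    using mono[of k v] mono[of "v+1" k] bounds enat by (cases "k \<le> v") auto
next
  case infinity
  \<comment> \<open>When no index qualifies in the definition, a partial sum of at most
    \<open>t\<close> forces the next one to be at most \<open>t\<close> as well.\<close>
  have "(\<Sum>j=m+1..m+i. x j) \<le> t" for i
  proof (induction i)
    case (Suc i)
    then show ?case
      using infinity by (auto simp: agent_value_def not_less simp del: sum.cl_ivl_Suc split: if_splits)
  qed (use t in simp)
  from this[of "k - m"] have "(\<Sum>j=m+1..k. x j) \<le> t"
    using t by (cases "m \<le> k") auto
  then show ?thesis
    using infinity by simp
qed


text \<open>Values are right-continuous where they are finite, so the infimum is attained. This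
  makes the total at \<open>\<tau>\<^sub>n\<close> at least \<open>n\<close>, which later forces
  some agent to be far advanced.\<close>

lemma growth_time_attained:
  assumes A: "1 \<le> A"
    and nn: "\<And>a j. a \<in> {1..A} \<Longrightarrow> 1 \<le> j \<Longrightarrow> 0 \<le> x a j"
    and fin: "\<And>a. a \<in> {1..A} \<Longrightarrow> growth_process A m x a n < \<infinity>"
  shows "0 \<le> growth_time A m x n"
    and "enat n \<le> (\<Sum>a=1..A. growth_process A m x a n)"
proof -
  define T where "T a k = (\<Sum>j=m a+1..k. x a j)" for a k
  define S where "S = {t. 0 \<le> t \<and> enat n \<le> (\<Sum>a=1..A. agent_value (m a) (x a) t)}"
  define \<tau> where "\<tau> = growth_time A m x n"
  have le_iff: "enat k \<le> agent_value (m a) (x a) t \<longleftrightarrow> T a k \<le> t"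
    if "a \<in> {1..A}" "0 \<le> t" for a k t
    unfolding T_def using nn that by (intro le_agent_value_iff) auto
  \<comment> \<open>Once agent 1 alone has reached \<open>n\<close>, so has the total.\<close>
  have "T 1 n \<in> S"
  proof -
    have "0 \<le> T 1 n"
      unfolding T_def using nn[of 1] A by (intro sum_nonneg) auto
    moreover from this have "enat n \<le> agent_value (m 1) (x 1) (T 1 n)"
      using le_iff[of 1] A by auto
    moreover have "agent_value (m 1) (x 1) (T 1 n) \<le> (\<Sum>a=1..A. agent_value (m a) (x a) (T 1 n))"
      using A by (intro member_le_sum) auto
    ultimately show ?thesis
      unfolding S_def by (auto intro: order_trans)
  qed
  then have S: "S \<noteq> {}" "bdd_below S"
    unfolding S_def by (auto intro!: bdd_belowI[of _ 0])
  have \<tau>: "\<tau> = (if n = 0 then 0 else Inf S)"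
    unfolding \<tau>_def growth_time_def S_def ..
  show nonneg: "0 \<le> growth_time A m x n"
    unfolding \<tau>_def[symmetric] \<tau> using S(1) by (auto intro!: cInf_greatest simp: S_def)
  define v where "v a = the_enat (growth_process A m x a n)" for a
  have v: "agent_value (m a) (x a) \<tau> = enat (v a)" if "a \<in> {1..A}" for a
    using fin[OF that] unfolding v_def growth_process_def \<tau>_def by auto
  \<comment> \<open>No agent moves in a short interval after \<open>\<tau>\<close>, so \<open>\<tau>\<close> itself belongs to \<open>S\<close>.\<close>
  have "\<tau> < T a (Suc (v a))" if "a \<in> {1..A}" for a
    using le_iff[OF that, of \<tau> "Suc (v a)"] v[OF that] nonneg
    unfolding \<tau>_def by (auto simp: not_le)
  then have less: "\<tau> < Min ((\<lambda>a. T a (Suc (v a))) ` {1..A})"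
    using A by auto
  show "enat n \<le> (\<Sum>a=1..A. growth_process A m x a n)"
  proof (cases "n = 0")
    case False
    with less S obtain t where t: "t \<in> S" "t < Min ((\<lambda>a. T a (Suc (v a))) ` {1..A})"
      unfolding \<tau> by (auto simp: cInf_less_iff)
    have "agent_value (m a) (x a) t \<le> agent_value (m a) (x a) \<tau>" if a: "a \<in> {1..A}" for a
    proof -
      have "t < T a (Suc (v a))"
        using t(2) a A by auto
      then have "\<not> enat (Suc (v a)) \<le> agent_value (m a) (x a) t"
        using le_iff[OF a, of t] t(1) unfolding S_def by auto
      then show ?thesis
        unfolding v[OF a] by (cases "agent_value (m a) (x a) t") auto
    qed
    then have "(\<Sum>a=1..A. agent_value (m a) (x a) t) \<le> (\<Sum>a=1..A. agent_value (m a) (x a) \<tau>)"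
      by (intro sum_mono) auto
    moreover have "enat n \<le> (\<Sum>a=1..A. agent_value (m a) (x a) t)"
      using t(1) unfolding S_def by auto
    ultimately show ?thesis
      unfolding growth_process_def \<tau>_def by (rule order_trans[rotated])
  qed (simp add: enat_0)
qed

text \<open>The deterministic core: the agent with the least limiting delay is ahead of each rival
  by a gap bounded away from 0, and vanishing waiting times let it take one further step within that
  gap.\<close>

lemma strict_leadership_if_limits_distinct:
  assumes A: "1 \<le> A"
    and nn: "\<And>a j. a \<in> {1..A} \<Longrightarrow> 1 \<le> j \<Longrightarrow> 0 \<le> x a j"
    and fin: "\<And>a n. a \<in> {1..A} \<Longrightarrow> growth_process A m x a n < \<infinity>"
    and null: "\<And>a. a \<in> {1..A} \<Longrightarrow> (\<lambda>j. x a (Suc j)) \<longlonglongrightarrow> 0"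
    and lim: "\<And>a b. \<lbrakk>a \<in> {1..A}; b \<in> {1..A}; a \<noteq> b\<rbrakk> \<Longrightarrow>
      \<exists>d. d \<noteq> 0 \<and> (\<lambda>k. (\<Sum>j=m a+1..k. x a j) - (\<Sum>j=m b+1..k. x b j)) \<longlonglongrightarrow> d"
  shows "strict_leadership A (growth_process A m x)"
proof -
  define T where "T a k = (\<Sum>j=m a+1..k. x a j)" for a k
  define v where "v = growth_process A m x"
  have one: "1 \<in> {1..A}" using A by auto
  \<comment> \<open>Agent 1 is the common reference, so that all pairwise limits become differences
    of a single function \<open>\<delta>\<close>, which has a minimum.\<close>
  have "\<exists>d. (\<lambda>k. T a k - T 1 k) \<longlonglongrightarrow> d" if "a \<in> {1..A}" for a
    using lim[OF that one] by (cases "a = 1") (auto simp: T_def)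
  then obtain \<delta> where \<delta>: "(\<lambda>k. T a k - T 1 k) \<longlonglongrightarrow> \<delta> a" if "a \<in> {1..A}" for a
    by metis
  have diff: "(\<lambda>k. T a k - T b k) \<longlonglongrightarrow> \<delta> a - \<delta> b" if "a \<in> {1..A}" "b \<in> {1..A}" for a b
    using tendsto_diff[OF \<delta>[OF that(1)] \<delta>[OF that(2)]] by simp
  obtain a where a: "a \<in> {1..A}" "\<And>b. b \<in> {1..A} \<Longrightarrow> \<delta> a \<le> \<delta> b"
    using ex_min_if_finite[of "\<delta> ` {1..A}"] one by (force simp: not_less)
  have "\<forall>\<^sub>F k in sequentially. T a (Suc k) < T b k" if b: "b \<in> {1..A} - {a}" for b
  proof -
    obtain d where d: "d \<noteq> 0" "(\<lambda>k. T a k - T b k) \<longlonglongrightarrow> d"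
      using lim[of a b] a b unfolding T_def by auto
    have "d = \<delta> a - \<delta> b"
      using LIMSEQ_unique[OF d(2) diff] a b by auto
    with a(2)[of b] b d(1) have "\<delta> a - \<delta> b < 0" by auto
    moreover have "(\<lambda>k. x a (Suc k) + (T a k - T b k)) \<longlonglongrightarrow> 0 + (\<delta> a - \<delta> b)"
      using a b by (intro tendsto_add null diff) auto
    ultimately have "\<forall>\<^sub>F k in sequentially. x a (Suc k) + (T a k - T b k) < 0"
      using order_tendstoD(2)[of _ "0 + (\<delta> a - \<delta> b)" sequentially 0] by fastforce
    \<comment> \<open>Only for \<open>m a \<le> k\<close> does the sum up to \<open>Suc k\<close>
      contain the extra term \<open>x a (Suc k)\<close>.\<close>
    moreover have "\<forall>\<^sub>F k in sequentially. m a \<le> k"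
      by (rule eventually_ge_at_top)
    ultimately show ?thesis
      by eventually_elim (auto simp: T_def)
  qed
  then have "\<forall>\<^sub>F k in sequentially. \<forall>b\<in>{1..A} - {a}. T a (Suc k) < T b k"
    by (intro eventually_ball_finite) auto
  then obtain K where K: "\<And>k b. \<lbrakk>K \<le> k; b \<in> {1..A} - {a}\<rbrakk> \<Longrightarrow> T a (Suc k) < T b k"
    unfolding eventually_sequentially by blast
  \<comment> \<open>A total above \<open>A * K\<close> puts some agent above \<open>K\<close>; by
    \<open>ahead\<close> agent \<open>a\<close> is then above \<open>K\<close> too. Rivals below
    \<open>K\<close> trail trivially, the others by \<open>ahead\<close>.\<close>
  have "\<forall>b\<in>{1..A} - {a}. v b n < v a n" if n: "A * K < n" for n
  proof -
    note \<tau> = growth_time_attained[of A x m n, OF A nn fin]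
    have le_iff: "enat k \<le> v c n \<longleftrightarrow> T c k \<le> growth_time A m x n" if "c \<in> {1..A}" for c k
      unfolding v_def growth_process_def T_def using nn that \<tau>(1)
      by (intro le_agent_value_iff) auto
    have ahead: "v b n < v a n" if b: "b \<in> {1..A} - {a}" "enat K \<le> v b n" for b
    proof -
      obtain k where k: "v b n = enat k"
        using fin[of b n] b unfolding v_def by auto
      then have "T a (Suc k) \<le> growth_time A m x n"
        using le_iff[of b k] K[of k b] b by auto
      then have "enat (Suc k) \<le> v a n"
        using le_iff[of a "Suc k"] a by auto
      then show ?thesis
        unfolding k by (cases "v a n") auto
    qed
    have "\<exists>c\<in>{1..A}. enat K < v c n"
    proof (rule ccontr)
      assume "\<not> ?thesis"
      then have "(\<Sum>c=1..A. v c n) \<le> (\<Sum>c=1..A. enat K)"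
        by (intro sum_mono) (auto simp: not_less)
      then have "(\<Sum>c=1..A. v c n) \<le> enat (A * K)"
        by (simp add: of_nat_eq_enat)
      with \<tau>(2) have "enat n \<le> enat (A * K)"
        unfolding v_def by (rule order_trans)
      then show False using n by auto
    qed
    then have "enat K < v a n"
      using ahead by (metis Diff_iff less_imp_le order_less_trans singletonD)
    then show ?thesis
      using ahead by (metis le_less_trans less_trans not_le)
  qed
  then show ?thesis
    unfolding strict_leadership_def v_def[symmetric] using a(1)
    by (auto intro!: bexI[of _ a] eventually_mono[OF eventually_gt_at_top[of "A * K"]])
qed

section \<open>Ties have probability zero\<close>

lemma (in prob_space) AE_eventually_not_if_sum_finite:
  assumes [measurable]: "\<And>n. Measurable.pred M (P n)"
    and sum: "(\<Sum>n. emeasure M {\<omega>\<in>space M. P n \<omega>}) < \<infinity>"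
  shows "AE \<omega> in M. \<forall>\<^sub>F n in sequentially. \<not> P n \<omega>"
proof -
  have "summable (\<lambda>n. measure M {\<omega>\<in>space M. P n \<omega>})"
    using sum by (intro summable_suminf_not_top) (auto simp: emeasure_eq_measure)
  from borel_cantelli_AE1[OF _ _ this] have
    "AE \<omega> in M. \<forall>\<^sub>F n in sequentially. \<omega> \<in> space M - {\<omega>\<in>space M. P n \<omega>}"
    by (simp add: emeasure_eq_measure)
  then show ?thesis
    by eventually_elim (auto elim: eventually_mono)
qed

text \<open>If missing every \<open>A j\<close> with \<open>j \<ge> n\<close> had probability
  \<open>c > 0\<close>, independence and \<open>1 - p \<le> exp (- p)\<close> would give
  \<open>c \<le> exp (- s)\<close> for each partial sum \<open>s\<close> of the \<open>p j\<close>
  from \<open>n\<close> on, hence \<open>s \<le> - ln c\<close> and a convergent series.\<close>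

lemma (in prob_space) AE_frequently_if_indep_sum_infinite:
  fixes Z :: "nat \<Rightarrow> 'a \<Rightarrow> 'b"
  assumes indep: "indep_vars S Z UNIV"
    and A: "\<And>n. A n \<in> sets (S n)"
    and sum: "(\<Sum>n. emeasure M {\<omega>\<in>space M. Z n \<omega> \<in> A n}) = \<infinity>"
  shows "AE \<omega> in M. \<exists>\<^sub>F n in sequentially. Z n \<omega> \<in> A n"
proof -
  define p where "p n = prob {\<omega>\<in>space M. Z n \<omega> \<in> A n}" for n
  have Z[measurable]: "Z n \<in> measurable M (S n)" for n
    using indep unfolding indep_vars_def by auto
  note A[measurable]
  have "prob {\<omega>\<in>space M. \<forall>j\<ge>n. Z j \<omega> \<notin> A j} = 0" (is "prob ?C = 0") for n
  proof (rule ccontr)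
    assume "prob ?C \<noteq> 0"
    then have pos: "0 < prob ?C"
      by (simp add: zero_less_measure_iff)
    have "(\<Sum>i\<le>k. p (i + n)) \<le> - ln (prob ?C)" for k
    proof -
      define J where "J = {n..k + n}"
      have "prob ?C \<le> prob (\<Inter>j\<in>J. Z j -` (space (S j) - A j) \<inter> space M)"
      proof (intro finite_measure_mono)
        show "?C \<subseteq> (\<Inter>j\<in>J. Z j -` (space (S j) - A j) \<inter> space M)"
          using measurable_space[OF Z] by (auto simp: J_def)
        show "(\<Inter>j\<in>J. Z j -` (space (S j) - A j) \<inter> space M) \<in> events"
          unfolding J_def by (intro sets.finite_INT measurable_sets[OF Z]) auto
      qed
      also have "\<dots> = (\<Prod>j\<in>J. prob (Z j -` (space (S j) - A j) \<inter> space M))"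
        by (intro indep_varsD[OF indep]) (auto simp: J_def)
      also have "\<dots> = (\<Prod>j\<in>J. 1 - p j)"
      proof (intro prod.cong refl)
        fix j
        have "Z j -` (space (S j) - A j) \<inter> space M = space M - {\<omega>\<in>space M. Z j \<omega> \<in> A j}"
          using measurable_space[OF Z] by auto
        then show "prob (Z j -` (space (S j) - A j) \<inter> space M) = 1 - p j"
          unfolding p_def by (simp add: prob_compl)
      qed
      also have "\<dots> \<le> (\<Prod>j\<in>J. exp (- p j))"
        using exp_ge_add_one_self[of "- p _"] by (intro prod_mono) (auto simp: p_def)
      also have "\<dots> = exp (- (\<Sum>j\<in>J. p j))"
        by (simp add: exp_sum J_def flip: sum_negf)
      finally have "ln (prob ?C) \<le> ln (exp (- (\<Sum>j\<in>J. p j)))"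
        using pos by (subst ln_le_cancel_iff) auto
      moreover have "(\<Sum>j\<in>J. p j) = (\<Sum>i\<le>k. p (i + n))"
        unfolding J_def using sum.shift_bounds_cl_nat_ivl[of p 0 n k] by (simp add: atLeast0AtMost)
      ultimately show ?thesis by simp
    qed
    then have "summable (\<lambda>i. p (i + n))"
      by (intro bounded_imp_summable) (auto simp: p_def)
    then have "summable p"
      by simp
    then have "(\<Sum>n. ennreal (p n)) \<noteq> \<infinity>"
      by (subst suminf_ennreal2) (auto simp: p_def)
    with sum show False
      unfolding p_def emeasure_eq_measure by simp
  qed
  then have "AE \<omega> in M. \<not> (\<forall>j\<ge>n. Z j \<omega> \<notin> A j)" for n
    by (subst (asm) prob_eq_0) auto
  then have "AE \<omega> in M. \<forall>n. \<not> (\<forall>j\<ge>n. Z j \<omega> \<notin> A j)"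
    by (simp add: AE_all_countable)
  then show ?thesis
    by eventually_elim (auto simp: frequently_sequentially)
qed

section \<open>Exchange invariance and the absence of an atom at 0\<close>

text \<open>The joint law of an independent family is the product of its marginals. Reindexing along
  an injection only reindexes the factors, and \<open>law\<close> makes these the original
  ones.\<close>

lemma (in prob_space) distr_permute_indep_vars:
  assumes indep: "indep_vars (\<lambda>_. S) Z I"
    and \<sigma>: "inj_on \<sigma> I" "\<sigma> \<in> I \<rightarrow> I"
    and law: "\<And>i. i \<in> I \<Longrightarrow> distr M S (Z (\<sigma> i)) = distr M S (Z i)"
  shows "distr M (PiM I (\<lambda>_. S)) (\<lambda>\<omega>. \<lambda>i\<in>I. Z (\<sigma> i) \<omega>) =
    distr M (PiM I (\<lambda>_. S)) (\<lambda>\<omega>. \<lambda>i\<in>I. Z i \<omega>)"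
proof (cases "I = {}")
  case True
  then show ?thesis by (simp add: restrict_def)
next
  case False
  have Z[measurable]: "Z i \<in> measurable M S" if "i \<in> I" for i
    using indep that unfolding indep_vars_def by auto
  define \<mu> where "\<mu> = (\<lambda>i. distr M S (Z i))"
  have PiM: "PiM I \<mu> = distr M (PiM I (\<lambda>_. S)) (\<lambda>\<omega>. \<lambda>i\<in>I. Z i \<omega>)"
    using indep_vars_iff_distr_eq_PiM'[of I Z "\<lambda>_. S"] False Z indep by (auto simp: \<mu>_def)
  have "distr M (PiM I (\<lambda>_. S)) (\<lambda>\<omega>. \<lambda>i\<in>I. Z (\<sigma> i) \<omega>) =
      distr (PiM I \<mu>) (PiM I (\<lambda>_. S)) (\<lambda>f. \<lambda>i\<in>I. f (\<sigma> i))"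
  proof -
    have "(\<lambda>f. \<lambda>i\<in>I. f (\<sigma> i)) \<in> measurable (PiM I (\<lambda>_. S)) (PiM I (\<lambda>_. S))"
      using \<sigma>(2) by (intro measurable_restrict measurable_component_singleton) auto
    moreover have "(\<lambda>\<omega>. \<lambda>i\<in>I. Z i \<omega>) \<in> measurable M (PiM I (\<lambda>_. S))"
      by measurable
    ultimately have "distr (PiM I \<mu>) (PiM I (\<lambda>_. S)) (\<lambda>f. \<lambda>i\<in>I. f (\<sigma> i)) =
        distr M (PiM I (\<lambda>_. S)) ((\<lambda>f. \<lambda>i\<in>I. f (\<sigma> i)) \<circ> (\<lambda>\<omega>. \<lambda>i\<in>I. Z i \<omega>))"
      unfolding PiM by (rule distr_distr)
    also have "(\<lambda>f. \<lambda>i\<in>I. f (\<sigma> i)) \<circ> (\<lambda>\<omega>. \<lambda>i\<in>I. Z i \<omega>) = (\<lambda>\<omega>. \<lambda>i\<in>I. Z (\<sigma> i) \<omega>)"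
      using \<sigma>(2) by (auto simp: fun_eq_iff)
    finally show ?thesis ..
  qed
  also have "\<dots> = distr (PiM I \<mu>) (PiM I (\<lambda>i. \<mu> (\<sigma> i))) (\<lambda>f. \<lambda>i\<in>I. f (\<sigma> i))"
    by (intro distr_cong sets_PiM_cong) (auto simp: \<mu>_def)
  also have "\<dots> = PiM I (\<lambda>i. \<mu> (\<sigma> i))"
    using \<sigma> Z by (intro distr_PiM_reindex) (auto simp: \<mu>_def intro: prob_space_distr)
  also have "\<dots> = PiM I \<mu>"
    using law by (intro PiM_cong) (auto simp: \<mu>_def)
  finally show ?thesis
    using PiM by simp
qed


text \<open>Here \<open>u\<close> and \<open>v\<close> list the waiting times of two agents within
  one independent family, and \<open>p\<close> and \<open>q\<close> stand for the initial values, so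
  the two sums may start at different indices.\<close>

lemma (in prob_space) AE_symmetrised_sums_not_null:
  fixes Z :: "'i \<Rightarrow> 'a \<Rightarrow> real" and u v :: "nat \<Rightarrow> 'i"
  assumes indep: "indep_vars (\<lambda>_. borel) Z I"
    and u: "inj u" "range u \<subseteq> I" and v: "inj v" "range v \<subseteq> I"
    and uv: "range u \<inter> range v = {}"
    and law: "\<And>j. distr M borel (Z (u j)) = distr M borel (Z (v j))"
    and null: "AE \<omega> in M. (\<lambda>j. Z (u j) \<omega> - Z (v j) \<omega>) \<longlonglongrightarrow> 0"
    and freq: "AE \<omega> in M. \<exists>\<^sub>F j in sequentially. Z (u j) \<omega> \<noteq> Z (v j) \<omega>"
  shows "AE \<omega> in M. \<not> (\<lambda>k. (\<Sum>j=p..<k. Z (u j) \<omega>) - (\<Sum>j=q..<k. Z (v j) \<omega>)) \<longlonglongrightarrow> 0"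
proof -
  let ?P = "PiM I (\<lambda>_. borel) :: ('i \<Rightarrow> real) measure"
  define d where "d f j = f (u j) - f (v j)" for f :: "'i \<Rightarrow> real" and j
  define D where "D f k = (\<Sum>j=p..<k. f (u j)) - (\<Sum>j=q..<k. f (v j))" for f :: "'i \<Rightarrow> real" and k
  \<comment> \<open>\<open>G\<close> marks the indices with a new nonzero absolute difference.
    Absolute values are used because the transposition \<open>\<sigma> j\<close> of
    \<open>u j\<close> and \<open>v j\<close> flips the sign of \<open>d f j\<close>.\<close>
  define G where "G f j \<longleftrightarrow> d f j \<noteq> 0 \<and> (\<forall>i<j. \<bar>d f i\<bar> \<noteq> \<bar>d f j\<bar>)" for f j
  define \<sigma> where "\<sigma> j i = (if i = u j then v j else if i = v j then u j else i)" for i j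
  \<comment> \<open>From \<open>r\<close> on, an index occurs in both sums once \<open>k\<close>
    exceeds it, so that an exchange there changes \<open>D\<close> by exactly
    \<open>2 * d f j\<close>.\<close>
  define r where "r = max p q"
  have [simp]: "u i = u j \<longleftrightarrow> i = j" "v i = v j \<longleftrightarrow> i = j" for i j
    using u v by (auto dest: injD)
  have [simp]: "u i \<noteq> v j" "v j \<noteq> u i" for i j
    using uv by (metis disjoint_iff rangeI)+
  have [simp]: "u j \<in> I" "v j \<in> I" for j
    using u v by auto
  have \<sigma>_simps [simp]: "\<sigma> j (u i) = (if i = j then v j else u i)"
    "\<sigma> j (v i) = (if i = j then u j else v i)" for i j
    by (auto simp: \<sigma>_def)
  have \<sigma>: "inj_on (\<sigma> j) I" "\<sigma> j \<in> I \<rightarrow> I" for j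
    by (auto simp: \<sigma>_def inj_on_def split: if_splits)
  have Z: "Z i \<in> borel_measurable M" if "i \<in> I" for i
    using indep that unfolding indep_vars_def by auto

  have swap_d: "d (\<lambda>i. f (\<sigma> j i)) i = (if i = j then - d f j else d f i)" for f i j
    by (auto simp: d_def)
  have swap_G: "G (\<lambda>i. f (\<sigma> j i)) i \<longleftrightarrow> G f i" for f i j
    unfolding G_def swap_d by (auto split: if_splits)
  have swap_D: "D (\<lambda>i. f (\<sigma> j i)) k = D f k - 2 * d f j" if "r \<le> j" "j < k" for f j k
  proof -
    have *: "(\<Sum>i=s..<k. if i = j then b else g i) = (\<Sum>i=s..<k. g i) - g j + b"
      if "s \<le> r" for g :: "nat \<Rightarrow> real" and b s
    proof -
      have j: "j \<in> {s..<k}"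
        using \<open>r \<le> j\<close> \<open>j < k\<close> that by auto
      have "(\<Sum>i\<in>{s..<k} - {j}. if i = j then b else g i) = (\<Sum>i\<in>{s..<k} - {j}. g i)"
        by (intro sum.cong) auto
      then show ?thesis
        using j by (simp add: sum.remove[OF _ j])
    qed
    show ?thesis
      unfolding D_def by (simp add: if_distrib[of f] * r_def d_def)
  qed

  define B where "B f j \<longleftrightarrow> G f j \<and> D f \<longlonglongrightarrow> 0" for f j
  have D_lim: "D f \<longlonglongrightarrow> 2 * d f j" if "B (\<lambda>i. f (\<sigma> j i)) j" "r \<le> j" for f j
  proof -
    have "D (\<lambda>i. f (\<sigma> j i)) \<longlonglongrightarrow> 0"
      using that unfolding B_def by auto
    then have "(\<lambda>k. D (\<lambda>i. f (\<sigma> j i)) k + 2 * d f j) \<longlonglongrightarrow> 2 * d f j"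
      by (auto intro: tendsto_eq_intros)
    moreover have "\<forall>\<^sub>F k in sequentially. D (\<lambda>i. f (\<sigma> j i)) k + 2 * d f j = D f k"
      using eventually_gt_at_top[of j] by eventually_elim (use that swap_D in auto)
    ultimately show ?thesis
      by (rule Lim_transform_eventually)
  qed
  \<comment> \<open>Both events would give \<open>D f\<close> the same limit, hence
    \<open>d f i = d f j\<close>; then the larger index does not carry a new absolute value.\<close>
  have disjoint: "i = j" if "B (\<lambda>l. f (\<sigma> i l)) i" "B (\<lambda>l. f (\<sigma> j l)) j" "r \<le> i" "r \<le> j" for f i j
  proof (rule ccontr)
    assume "i \<noteq> j"
    have "d f i = d f j"
      using LIMSEQ_unique[OF D_lim[OF that(1,3)] D_lim[OF that(2,4)]] by simp
    moreover have "G f i" "G f j"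
      using that unfolding B_def swap_G by auto
    ultimately show False
      using \<open>i \<noteq> j\<close> unfolding G_def by (metis linorder_neqE_nat)
  qed

  have [measurable]: "(\<lambda>f. f (u j)) \<in> borel_measurable ?P" "(\<lambda>f. f (v j)) \<in> borel_measurable ?P" for j
    by (simp_all add: measurable_component_singleton)
  have [measurable]: "(\<lambda>f. d f j) \<in> borel_measurable ?P" "(\<lambda>f. D f j) \<in> borel_measurable ?P" for j
    unfolding D_def d_def by simp_all
  have [measurable]: "Measurable.pred ?P (\<lambda>f. G f j)" for j
  proof -
    have "Measurable.pred ?P (\<lambda>f. d f j = 0)" "Measurable.pred ?P (\<lambda>f. \<bar>d f i\<bar> = \<bar>d f j\<bar>)" for i
      unfolding pred_def by (intro borel_measurable_eq; measurable)+
    then show ?thesis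
      unfolding G_def by (intro pred_intros_logic pred_intros_countable) auto
  qed
  have [measurable]: "Measurable.pred ?P (\<lambda>f. D f \<longlonglongrightarrow> 0)"
    by (rule measurable_limit) measurable
  have B_meas [measurable]: "Measurable.pred ?P (\<lambda>f. B f j)" for j
    unfolding B_def by measurable
  have fam: "(\<lambda>\<omega>. \<lambda>i\<in>I. Z (\<tau> i) \<omega>) \<in> measurable M ?P" if "\<tau> \<in> I \<rightarrow> I" for \<tau>
    using that by (intro measurable_restrict Z) auto
  \<comment> \<open>\<open>B\<close> reads only coordinates in \<open>I\<close>, so it can be
    evaluated in the product space, where the laws are compared.\<close>
  have B_restrict: "B (\<lambda>i\<in>I. f i) j \<longleftrightarrow> B f j" for f j
  proof -
    have "D (\<lambda>i\<in>I. f i) = D f"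
      by (simp add: D_def fun_eq_iff)
    then show ?thesis
      by (simp add: B_def G_def d_def)
  qed
  have emeasure_B: "emeasure M {\<omega>\<in>space M. B (\<lambda>i. Z (\<tau> i) \<omega>) j} =
      emeasure (distr M ?P (\<lambda>\<omega>. \<lambda>i\<in>I. Z (\<tau> i) \<omega>)) {f\<in>space ?P. B f j}"
    and B_pred: "Measurable.pred M (\<lambda>\<omega>. B (\<lambda>i. Z (\<tau> i) \<omega>) j)" if "\<tau> \<in> I \<rightarrow> I" for \<tau> j
  proof -
    have eq: "{\<omega>\<in>space M. B (\<lambda>i. Z (\<tau> i) \<omega>) j} =
        (\<lambda>\<omega>. \<lambda>i\<in>I. Z (\<tau> i) \<omega>) -` {f\<in>space ?P. B f j} \<inter> space M"
      using measurable_space[OF fam[OF that]] by (auto simp: B_restrict)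
    then show "emeasure M {\<omega>\<in>space M. B (\<lambda>i. Z (\<tau> i) \<omega>) j} =
        emeasure (distr M ?P (\<lambda>\<omega>. \<lambda>i\<in>I. Z (\<tau> i) \<omega>)) {f\<in>space ?P. B f j}"
      using fam[OF that] by (subst emeasure_distr) auto
    have "{\<omega>\<in>space M. B (\<lambda>i. Z (\<tau> i) \<omega>) j} \<in> events"
      unfolding eq using fam[OF that] by (rule measurable_sets) measurable
    then show "Measurable.pred M (\<lambda>\<omega>. B (\<lambda>i. Z (\<tau> i) \<omega>) j)"
      by (simp add: pred_def)
  qed
  have swap: "emeasure M {\<omega>\<in>space M. B (\<lambda>i. Z i \<omega>) j} =
      emeasure M {\<omega>\<in>space M. B (\<lambda>i. Z (\<sigma> j i) \<omega>) j}" for j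
  proof -
    have "distr M ?P (\<lambda>\<omega>. \<lambda>i\<in>I. Z (\<sigma> j i) \<omega>) = distr M ?P (\<lambda>\<omega>. \<lambda>i\<in>I. Z i \<omega>)"
      using law by (intro distr_permute_indep_vars indep \<sigma>) (auto simp: \<sigma>_def)
    then show ?thesis
      using emeasure_B[of "\<lambda>i. i" j] emeasure_B[OF \<sigma>(2), of j j] by simp
  qed
  \<comment> \<open>Each event is replaced by its exchanged version of equal probability; those are
    disjoint, so the sum is the probability of a union.\<close>
  have "(\<Sum>j. emeasure M {\<omega>\<in>space M. B (\<lambda>i. Z i \<omega>) (j + r)}) =
      (\<Sum>j. emeasure M {\<omega>\<in>space M. B (\<lambda>i. Z (\<sigma> (j + r) i) \<omega>) (j + r)})"
    by (simp only: swap)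
  also have "\<dots> = emeasure M (\<Union>j. {\<omega>\<in>space M. B (\<lambda>i. Z (\<sigma> (j + r) i) \<omega>) (j + r)})"
    using B_pred[OF \<sigma>(2)] disjoint
    by (intro suminf_emeasure) (fastforce simp: disjoint_family_on_def pred_def)+
  also have "\<dots> < \<infinity>"
    by (simp add: emeasure_eq_measure)
  finally have "AE \<omega> in M. \<forall>\<^sub>F j in sequentially. \<not> B (\<lambda>i. Z i \<omega>) (j + r)"
    by (intro AE_eventually_not_if_sum_finite) (use B_pred[of "\<lambda>i. i"] in auto)
  with null freq show ?thesis
  proof eventually_elim
    case (elim \<omega>)
    let ?f = "\<lambda>i. Z i \<omega>"
    show ?case
    proof
      assume "(\<lambda>k. (\<Sum>j=p..<k. Z (u j) \<omega>) - (\<Sum>j=q..<k. Z (v j) \<omega>)) \<longlonglongrightarrow> 0"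
      then have "D ?f \<longlonglongrightarrow> 0"
        unfolding D_def .
      with elim(3) have "\<forall>\<^sub>F j in sequentially. \<not> G ?f (j + r)"
        unfolding B_def by simp
      then have "\<forall>\<^sub>F j in sequentially. \<not> G ?f j"
        by (rule eventually_sequentially_seg[of "\<lambda>j. \<not> G ?f j" r, THEN iffD1])
      then obtain n where n: "\<And>j. n \<le> j \<Longrightarrow> \<not> G ?f j"
        unfolding eventually_sequentially by blast
      have nz: "\<exists>j\<ge>k. d ?f j \<noteq> 0" for k
        using elim(2) unfolding frequently_sequentially d_def by auto
      \<comment> \<open>Without new absolute values from \<open>n\<close> on, every nonzero one can
        be traced back below \<open>n\<close>. The finitely many values there have a least nonzero
        one \<open>e\<close>, against \<open>d ?f\<close> tending to 0 while being nonzero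
        infinitely often.\<close>
      have "\<exists>i<n. \<bar>d ?f j\<bar> = \<bar>d ?f i\<bar>" if "d ?f j \<noteq> 0" for j
        using that
      proof (induction j rule: less_induct)
        case (less j)
        show ?case
        proof (cases "j < n")
          case False
          then have "\<exists>i<j. \<bar>d ?f i\<bar> = \<bar>d ?f j\<bar>"
            using n[of j] less.prems unfolding G_def by auto
          then show ?thesis
            using less.IH less.prems by (metis abs_eq_0)
        qed auto
      qed
      then have abs_values: "\<bar>d ?f j\<bar> \<in> (\<lambda>i. \<bar>d ?f i\<bar>) ` {..<n} - {0}" if "d ?f j \<noteq> 0" for j
        using that by force
      define e where "e = Min ((\<lambda>i. \<bar>d ?f i\<bar>) ` {..<n} - {0})"
      have fin: "finite ((\<lambda>i. \<bar>d ?f i\<bar>) ` {..<n} - {0})"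
        by simp
      moreover have "(\<lambda>i. \<bar>d ?f i\<bar>) ` {..<n} - {0} \<noteq> {}"
        using nz[of 0] abs_values by blast
      ultimately have "e \<in> (\<lambda>i. \<bar>d ?f i\<bar>) ` {..<n} - {0}"
        unfolding e_def by (rule Min_in)
      then have "0 < e"
        by auto
      moreover have "(d ?f) \<longlonglongrightarrow> 0"
        using elim(1) unfolding d_def .
      ultimately obtain k where k: "\<And>j. k \<le> j \<Longrightarrow> \<bar>d ?f j\<bar> < e"
        by (auto simp: LIMSEQ_iff)
      obtain j where "k \<le> j" "d ?f j \<noteq> 0"
        using nz by blast
      then show False
        using k[of j] Min_le[OF fin abs_values[of j]] unfolding e_def by auto
    qed
  qed
qed

section \<open>Waiting times of competing agents\<close>

lemma measurable_as_seq [measurable (raw)]: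
  assumes "\<And>j. 1 \<le> j \<Longrightarrow> Z j \<in> borel_measurable M"
  shows "as_seq Z \<in> measurable M seq_space"
  using assms by (intro measurable_restrict) auto

context competing_growth
begin

lemma waiting_measurable:
  assumes "a \<in> {1..A}" "1 \<le> j"
  shows "X a j \<in> borel_measurable M"
  using waiting_indep assms unfolding indep_vars_def by auto

lemma waiting_seq_indep:
  assumes a: "a \<in> {1..A}" and b: "b \<in> {1..A}" and ab: "a \<noteq> b"
  shows "indep_var seq_space (as_seq (X a)) seq_space (as_seq (X b))"
proof -
  let ?P = "\<lambda>c. PiM ({c} \<times> {1..}) (\<lambda>_. borel) :: (nat \<times> nat \<Rightarrow> real) measure"
  let ?h = "\<lambda>c f. \<lambda>j\<in>{1..}. f (c, j)"
  let ?r = "\<lambda>c \<omega>. restrict (\<lambda>i. (\<lambda>(a, j). X a j) i \<omega>) ({c} \<times> {1..})"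
  have h: "?h c \<in> measurable (?P c) seq_space" for c
    by (intro measurable_restrict measurable_component_singleton) auto
  have "indep_var (?P a) (?r a) (?P b) (?r b)"
    using a b ab by (intro indep_var_restrict[OF waiting_indep]) auto
  from indep_var_compose[OF this h h]
  have "indep_var seq_space (?h a \<circ> ?r a) seq_space (?h b \<circ> ?r b)" .
  moreover have "?h c \<circ> ?r c = as_seq (X c)" for c
    by (auto simp: fun_eq_iff)
  ultimately show ?thesis
    by simp
qed

text \<open>The differences are functions of the blocks \<open>{(a, Suc j), (b, Suc j)}\<close>,
  which are disjoint for distinct \<open>j\<close>.\<close>

lemma waiting_diff_indep:
  assumes a: "a \<in> {1..A}" and b: "b \<in> {1..A}" and ab: "a \<noteq> b"
  shows "indep_vars (\<lambda>_. borel) (\<lambda>j \<omega>. X a (Suc j) \<omega> - X b (Suc j) \<omega>) UNIV"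
proof -
  let ?K = "\<lambda>j. {(a, Suc j), (b, Suc j)}"
  have "indep_vars (\<lambda>j. PiM (?K j) (\<lambda>_. borel))
      (\<lambda>j \<omega>. restrict (\<lambda>i. (\<lambda>(a, j). X a j) i \<omega>) (?K j)) UNIV"
    using a b by (intro indep_vars_restrict[OF waiting_indep]) (auto simp: disjoint_family_on_def)
  then have "indep_vars (\<lambda>_. borel) (\<lambda>j \<omega>. (\<lambda>f. f (a, Suc j) - f (b, Suc j))
      (restrict (\<lambda>i. (\<lambda>(a, j). X a j) i \<omega>) (?K j))) UNIV"
    by (rule indep_vars_compose2)
      (auto intro!: borel_measurable_diff measurable_component_singleton)
  then show ?thesis
    by simp
qed

text \<open>Both sides are the product of the same two marginals. This carries statements about the
  auxiliary pair over to any two distinct agents.\<close>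

lemma waiting_pair_law:
  assumes a: "a \<in> {1..A}" and b: "b \<in> {1..A}" and ab: "a \<noteq> b"
    and N: "prob_space N" "prob_space.indep_var N seq_space (as_seq Y) seq_space (as_seq Y')"
    and law: "seq_law N Y = seq_law M (X 1)" "seq_law N Y' = seq_law M (X 1)"
  shows "distr M (seq_space \<Otimes>\<^sub>M seq_space) (\<lambda>\<omega>. (as_seq (X a) \<omega>, as_seq (X b) \<omega>)) =
    distr N (seq_space \<Otimes>\<^sub>M seq_space) (\<lambda>\<omega>. (as_seq Y \<omega>, as_seq Y' \<omega>))"
proof -
  interpret N: prob_space N by fact
  have one: "1 \<in> {1..A}"
    using two_agents by auto
  have "distr M (seq_space \<Otimes>\<^sub>M seq_space) (\<lambda>\<omega>. (as_seq (X a) \<omega>, as_seq (X b) \<omega>)) =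
      seq_law M (X a) \<Otimes>\<^sub>M seq_law M (X b)"
    using waiting_seq_indep[OF a b ab] unfolding indep_var_distribution_eq seq_law_def by simp
  also have "\<dots> = seq_law N Y \<Otimes>\<^sub>M seq_law N Y'"
    using law waiting_same_law[OF a one] waiting_same_law[OF b one] by simp
  also have "\<dots> = distr N (seq_space \<Otimes>\<^sub>M seq_space) (\<lambda>\<omega>. (as_seq Y \<omega>, as_seq Y' \<omega>))"
    using N(2) unfolding N.indep_var_distribution_eq seq_law_def by simp
  finally show ?thesis .
qed

lemma waiting_law:
  assumes "a \<in> {1..A}" "b \<in> {1..A}" "1 \<le> j"
  shows "distr M borel (X a j) = distr M borel (X b j)"
proof -
  have "distr M borel (X c j) = distr (seq_law M (X c)) borel (\<lambda>f. f j)" if "c \<in> {1..A}" for c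
    unfolding seq_law_def using waiting_measurable[OF that] assms(3)
    by (subst distr_distr) (auto simp: comp_def)
  then show ?thesis
    using assms waiting_same_law[of a b] by simp
qed

text \<open>Borel-Cantelli is applied at the countably many levels
  \<open>inverse (real (Suc n))\<close>; nonnegativity bounds the other side.\<close>

lemma waiting_tendsto_0:
  assumes a: "a \<in> {1..A}"
    and sum: "\<And>\<epsilon>::real. 0 < \<epsilon> \<Longrightarrow> (\<Sum>j. emeasure M {\<omega>\<in>space M. X a (Suc j) \<omega> > \<epsilon>}) < \<infinity>"
  shows "AE \<omega> in M. (\<lambda>j. X a (Suc j) \<omega>) \<longlonglongrightarrow> 0"
proof -
  have [measurable]: "X a (Suc j) \<in> borel_measurable M" for j
    using waiting_measurable[OF a] by simp
  have "AE \<omega> in M. \<forall>\<^sub>F j in sequentially. \<not> X a (Suc j) \<omega> > inverse (real (Suc n))" for n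
    by (intro AE_eventually_not_if_sum_finite sum) auto
  then have "AE \<omega> in M. \<forall>n. \<forall>\<^sub>F j in sequentially. \<not> X a (Suc j) \<omega> > inverse (real (Suc n))"
    by (simp add: AE_all_countable)
  then show ?thesis
    using AE_space
  proof eventually_elim
    case (elim \<omega>)
    show ?case
    proof (rule order_tendstoI)
      fix e :: real assume "0 < e"
      then obtain n where n: "inverse (real (Suc n)) < e"
        using reals_Archimedean by blast
      show "\<forall>\<^sub>F j in sequentially. X a (Suc j) \<omega> < e"
        using elim(1)[rule_format, of n] by eventually_elim (use n in auto)
    next
      fix e :: real assume "e < 0"
      then show "\<forall>\<^sub>F j in sequentially. e < X a (Suc j) \<omega>"
        using waiting_nonneg[OF a _ elim(2)] by (intro always_eventually) (auto intro: less_le_trans)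
    qed
  qed
qed

text \<open>The initial values alter the series of differences only by a constant, so summability
  gives the limit, and the absence of ties makes it nonzero.\<close>

lemma arrival_difference_limit:
  assumes a: "a \<in> {1..A}" and b: "b \<in> {1..A}" and ab: "a \<noteq> b"
    and summable: "AE \<omega> in M. summable (\<lambda>j. X a (Suc j) \<omega> - X b (Suc j) \<omega>)"
    and sum: "(\<Sum>j. emeasure M {\<omega>\<in>space M. X a (Suc j) \<omega> - X b (Suc j) \<omega> \<noteq> 0}) = \<infinity>"
  shows "AE \<omega> in M. \<exists>d. d \<noteq> 0 \<and>
    (\<lambda>k. (\<Sum>j=m a+1..k. X a j \<omega>) - (\<Sum>j=m b+1..k. X b j \<omega>)) \<longlonglongrightarrow> d"
proof -
  have shift: "(\<Sum>j=s+1..k. x j) = (\<Sum>j=s..<k. x (Suc j))" for s k and x :: "nat \<Rightarrow> real"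
    using sum.shift_bounds_Suc_ivl[of x s k] by (simp add: atLeastLessThanSuc_atLeastAtMost)
  have "AE \<omega> in M. \<exists>\<^sub>F j in sequentially. X a (Suc j) \<omega> - X b (Suc j) \<omega> \<in> - {0}"
    using sum by (intro AE_frequently_if_indep_sum_infinite[OF waiting_diff_indep[OF a b ab]]) auto
  moreover have "AE \<omega> in M. (\<lambda>j. X a (Suc j) \<omega> - X b (Suc j) \<omega>) \<longlonglongrightarrow> 0"
    using summable by eventually_elim (rule summable_LIMSEQ_zero)
  \<comment> \<open>The sums are written through the whole family so that
    \<open>u j = (a, Suc j)\<close> and \<open>v j = (b, Suc j)\<close> can be read off.\<close>
  ultimately have "AE \<omega> in M. \<not> (\<lambda>k. (\<Sum>j=m a..<k. (\<lambda>(c, j). X c j) (a, Suc j) \<omega>) -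
      (\<Sum>j=m b..<k. (\<lambda>(c, j). X c j) (b, Suc j) \<omega>)) \<longlonglongrightarrow> 0"
    using a b ab waiting_law[OF a b]
    by (intro AE_symmetrised_sums_not_null[OF waiting_indep]) (auto simp: inj_def)
  with summable show ?thesis
  proof eventually_elim
    case (elim \<omega>)
    let ?x = "\<lambda>c j. X c (Suc j) \<omega>"
    let ?D = "\<lambda>k. (\<Sum>j=m a..<k. ?x a j) - (\<Sum>j=m b..<k. ?x b j)"
    \<comment> \<open>The correction for the initial segments that the two agents skip.\<close>
    let ?c = "(\<Sum>j<m b. ?x b j) - (\<Sum>j<m a. ?x a j)"
    have split: "(\<Sum>j<k. x j) - (\<Sum>j<s. x j) = (\<Sum>j=s..<k. x j)" if "s \<le> k"
      for s k and x :: "nat \<Rightarrow> real"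
      using sum_diff_nat_ivl[of 0 s k x] that by (simp add: lessThan_atLeast0)
    have "\<forall>\<^sub>F k in sequentially. (\<Sum>j<k. ?x a j - ?x b j) + ?c = ?D k"
      using eventually_ge_at_top[of "max (m a) (m b)"]
    proof eventually_elim
      case (elim k)
      then show ?case
        using split[of "m a" k "?x a"] split[of "m b" k "?x b"] by (simp add: sum_subtractf)
    qed
    moreover have "(\<lambda>k. (\<Sum>j<k. ?x a j - ?x b j) + ?c) \<longlonglongrightarrow> (\<Sum>j. ?x a j - ?x b j) + ?c"
      by (intro tendsto_add summable_LIMSEQ elim tendsto_const)
    ultimately have "?D \<longlonglongrightarrow> (\<Sum>j. ?x a j - ?x b j) + ?c"
      by (rule Lim_transform_eventually[rotated])
    then show ?case
      using elim(2) unfolding shift by (intro exI[of _ "(\<Sum>j. ?x a j - ?x b j) + ?c"]) auto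
  qed
qed

end

section \<open>Transfer of the hypotheses to the agents, and strict leadership\<close>

theorem corollary1p8:
  fixes M :: "'a measure" and A :: nat and m :: "nat \<Rightarrow> nat"
    and X :: "nat \<Rightarrow> nat \<Rightarrow> 'a \<Rightarrow> real"
    and N :: "'b measure" and Y Y' :: "nat \<Rightarrow> 'b \<Rightarrow> real"
  assumes "competing_growth M A m X"
    and "prob_space N"
    and "prob_space.indep_var N seq_space (as_seq Y) seq_space (as_seq Y')"
    and "seq_law N Y = seq_law M (X 1)"
    and "seq_law N Y' = seq_law M (X 1)"
    and "AE \<omega> in N. summable (\<lambda>j. Y (Suc j) \<omega> - Y' (Suc j) \<omega>)"
    and "(\<Sum>j. emeasure N {\<omega>\<in>space N. Y (Suc j) \<omega> - Y' (Suc j) \<omega> \<noteq> 0}) = \<infinity>"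
    and "\<And>\<epsilon>::real. 0 < \<epsilon> \<Longrightarrow> (\<Sum>j. emeasure N {\<omega>\<in>space N. Y (Suc j) \<omega> > \<epsilon>}) < \<infinity>"
  shows "AE \<omega> in M. strict_leadership A (growth_process A m (\<lambda>a j. X a j \<omega>))"
proof -
  interpret competing_growth M A m X by fact
  interpret N: prob_space N by fact
  let ?S = "seq_space \<Otimes>\<^sub>M seq_space"
  let ?Y = "\<lambda>\<omega>. (as_seq Y \<omega>, as_seq Y' \<omega>)"
  let ?X = "\<lambda>a b \<omega>. (as_seq (X a) \<omega>, as_seq (X b) \<omega>)"
  have Y: "?Y \<in> measurable N ?S"
    using assms(3) unfolding N.indep_var_distribution_eq by (intro measurable_Pair) auto
  have X: "?X a b \<in> measurable M ?S" if "a \<in> {1..A}" "b \<in> {1..A}" for a b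
    using waiting_measurable that by (intro measurable_Pair measurable_as_seq) auto
  have [measurable]: "(\<lambda>p. fst p (Suc j)) \<in> borel_measurable ?S"
    "(\<lambda>p. snd p (Suc j)) \<in> borel_measurable ?S" for j
    by (auto intro: measurable_compose[OF measurable_fst] measurable_compose[OF measurable_snd]
        measurable_component_singleton)
  have AE_transfer: "AE \<omega> in M. P (?X a b \<omega>)"
    if "a \<in> {1..A}" "b \<in> {1..A}" "a \<noteq> b" "Measurable.pred ?S P" "AE \<omega> in N. P (?Y \<omega>)" for a b P
  proof -
    have P: "{p\<in>space ?S. P p} \<in> sets ?S"
      using that(4) by (simp only: pred_def)
    have "AE p in distr M ?S (?X a b). P p"
      using that(5) AE_distr_iff[OF Y P] waiting_pair_law[OF that(1-3) assms(2-5)] by metis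
    then show ?thesis
      using AE_distr_iff[OF X[OF that(1,2)] P] by metis
  qed
  have emeasure_transfer: "emeasure M {\<omega>\<in>space M. P (?X a b \<omega>)} = emeasure N {\<omega>\<in>space N. P (?Y \<omega>)}"
    if "a \<in> {1..A}" "b \<in> {1..A}" "a \<noteq> b" "Measurable.pred ?S P" for a b P
  proof -
    have "emeasure (distr M ?S (?X a b)) {p\<in>space ?S. P p} = emeasure (distr N ?S ?Y) {p\<in>space ?S. P p}"
      using waiting_pair_law[OF that(1-3) assms(2-5)] by simp
    moreover have "?X a b -` {p\<in>space ?S. P p} \<inter> space M = {\<omega>\<in>space M. P (?X a b \<omega>)}"
      using measurable_space[OF X[OF that(1,2)]] by auto
    moreover have "?Y -` {p\<in>space ?S. P p} \<inter> space N = {\<omega>\<in>space N. P (?Y \<omega>)}"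
      using measurable_space[OF Y] by auto
    ultimately show ?thesis
      using that(4) emeasure_distr[OF X[OF that(1,2)]] emeasure_distr[OF Y] by (simp add: pred_def)
  qed
  have limits: "AE \<omega> in M. \<exists>d. d \<noteq> 0 \<and>
      (\<lambda>k. (\<Sum>j=m a+1..k. X a j \<omega>) - (\<Sum>j=m b+1..k. X b j \<omega>)) \<longlonglongrightarrow> d"
    if ab: "a \<in> {1..A}" "b \<in> {1..A}" "a \<noteq> b" for a b
  proof (rule arrival_difference_limit[OF ab])
    \<comment> \<open>Convergence is expressed by the Cauchy property, a countable condition on the
      partial sums.\<close>
    have "Measurable.pred ?S (\<lambda>p. summable (\<lambda>j. fst p (Suc j) - snd p (Suc j)))"
      unfolding summable_iff_convergent Cauchy_convergent_iff[symmetric] pred_def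
      by (intro sets_Collect_Cauchy) measurable
    from AE_transfer[OF ab this] assms(6)
    show "AE \<omega> in M. summable (\<lambda>j. X a (Suc j) \<omega> - X b (Suc j) \<omega>)"
      by simp
    have "Measurable.pred ?S (\<lambda>p. fst p (Suc j) - snd p (Suc j) \<noteq> 0)" for j
      unfolding pred_def by (intro borel_measurable_neq; measurable)
    from emeasure_transfer[OF ab this] assms(7)
    show "(\<Sum>j. emeasure M {\<omega>\<in>space M. X a (Suc j) \<omega> - X b (Suc j) \<omega> \<noteq> 0}) = \<infinity>"
      by simp
  qed
  have null: "AE \<omega> in M. (\<lambda>j. X a (Suc j) \<omega>) \<longlonglongrightarrow> 0" if a: "a \<in> {1..A}" for a
  proof (rule waiting_tendsto_0[OF a])
    fix \<epsilon> :: real assume \<epsilon>: "0 < \<epsilon>"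
    \<comment> \<open>The transfer concerns pairs, so a second agent completes the pair although the
      event depends on the first component only.\<close>
    obtain b where b: "b \<in> {1..A}" "a \<noteq> b"
    proof
      show "(if a = 1 then 2 else 1) \<in> {1..A}" "a \<noteq> (if a = 1 then 2 else 1)"
        using two_agents by auto
    qed
    have "Measurable.pred ?S (\<lambda>p. fst p (Suc j) > \<epsilon>)" for j
      by measurable
    from emeasure_transfer[OF a b this] assms(8)[OF \<epsilon>]
    show "(\<Sum>j. emeasure M {\<omega>\<in>space M. X a (Suc j) \<omega> > \<epsilon>}) < \<infinity>"
      by simp
  qed
  have "AE \<omega> in M. \<forall>a\<in>{1..A}. (\<lambda>j. X a (Suc j) \<omega>) \<longlonglongrightarrow> 0"
    using null by (intro AE_finite_allI) auto
  moreover have "AE \<omega> in M. \<forall>a\<in>{1..A}. \<forall>b\<in>{1..A} - {a}. \<exists>d. d \<noteq> 0 \<and>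
      (\<lambda>k. (\<Sum>j=m a+1..k. X a j \<omega>) - (\<Sum>j=m b+1..k. X b j \<omega>)) \<longlonglongrightarrow> d"
    using limits by (intro AE_finite_allI) auto
  ultimately show ?thesis
    using process_finite AE_space
  proof eventually_elim
    case (elim \<omega>)
    show ?case
    proof (rule strict_leadership_if_limits_distinct)
      show "1 \<le> A"
        using two_agents by simp
    qed (use elim waiting_nonneg in auto)
  qed
qed

end
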